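(* Every $\text{PCTL}_{\mathit{safe}}$-formula is a safety property.
   Context: Fix a finite non-empty set $\mathit{AP}$. A probabilistic tree (PT) is $T=(W,L,P)$ with $\epsilon\notin W$, $W\cup\{\epsilon\}\subseteq\mathbb{N}^*$ prefix-closed, $L:W\to\mathcal{P}(\mathit{AP})$, and $P$ a partial function from $W$ to distributions over $W$ with $P(\pi)(\pi')>0$ iff $\pi'=\pi\cdot n\in W$ for some $n$. $T$ is total if every node is a proper prefix of some node; finite-depth if node lengths are bounded. $\mathbb{T}^\omega$, $\mathbb{T}^*$: sets of total, finite-depth PTs. For $T_1\in\mathbb{T}^*$, $T_1\preceq T_2$ iff $W_1\subseteq W_2$, $L_2|_{W_1}=L_1$ and $P_2|_{W_1\times W_1}=P_1$. $\mathit{Pre}_{\mathit{fin}}(T)=\{T_1\in\mathbb{T}^*\mid T_1\preceq T\}$. A property $P\subseteq\mathbb{T}^\omega$ is a safety property iff for all $T\in\mathbb{T}^\omega$: $T\in P$ iff every $T_1\in\mathit{Pre}_{\mathit{fin}}(T)$ has some $T_2\in P$ with $T_1\preceq T_2$. A Markov chain (MC) is $\mathsf{D}=(S,\mathit{AP},\to,L,s_0)$ with $S\subseteq\mathbb{N}$ countable, $\to:S\to\mathit{Dist}(S)$ total, $L:S\to\mathcal{P}(\mathit{AP})$, initial state $s_0$. Its unfolding $T(\mathsf{D})$ has as nodes the least set of state sequences containing $s_0$ and closed under appending a state $t$ with $\mu(t)>0$ where $\mathrm{last}(\pi)\to\mu$; labels $L(\mathrm{last}(\pi))$; edge probabilities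 $P(\pi,\pi')=\mu(\mathrm{last}(\pi'))$ with $\mathrm{last}(\pi)\to\mu$. PCTL: state formulas $\Phi::=a\mid\Phi_1\land\Phi_2\mid\neg\Phi\mid\mathbb{P}_{\bowtie q}(\varphi)$, path formulas $\varphi::=\mathsf{X}\Phi\mid\Phi_1\mathsf{U}\Phi_2\mid\Phi_1\mathsf{W}\Phi_2$, $\bowtie\in\{<,>,\le,\ge\}$, $q\in[0,1]$, standard semantics on MCs ($\pi\models\Phi_1\mathsf{W}\Phi_2$ iff $\pi\models\Phi_1\mathsf{U}\Phi_2$ or all states of $\pi$ satisfy $\Phi_1$); formulas are taken in positive normal form (negation only applied to atomic propositions, $\lor$ available). $P_\Phi=\{T(\mathsf{D})\mid\mathsf{D}\models\Phi\}$ ($\mathsf{D}\models\Phi$ iff the initial state satisfies $\Phi$); $\Phi$ is a safety property iff $P_\Phi$ is. Literal formulas: $\Phi^a::=a\mid\neg\Phi^a\mid\Phi^a_1\land\Phi^a_2$. $\text{PCTL}_{\mathit{safe}}$ is the smallest set $\mathcal{F}$ of PCTL formulas such that: (1) every literal formula $\Phi^a\in\mathcal{F}$; (2) if $\Phi\in\mathcal{F}$ then $\mathbb{P}_{\ge q}(\mathsf{X}\Phi)\in\mathcal{F}$; (3) if $\Phi_1,\Phi_2\in\mathcal{F}$ then $\Phi_1\land\Phi_2$, $\Phi_1\lor\Phi_2$, $\mathbb{P}_{\ge q}(\Phi_1\mathsf{W}\Phi_2)\in\mathcal{F}$; (4) if $\neg\Phi_1,\neg\Phi_2\in\mathcal{F}$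 then $\mathbb{P}_{\le q}(\Phi_1\mathsf{U}\Phi_2)\in\mathcal{F}$.
   Formalization: Probabilistic trees are required to have a non-empty node set W; otherwise the empty tree would be total, its only finite prefix would precede every unfolding, and no satisfiable formula would be a safety property. *)

theory Defs
  imports "HOL-Probability.Probability" "HOL-Library.Sublist"
begin

section \<open>Probabilistic trees\<close>

text \<open>
  The labelling and the distributions are partial maps that are undefined outside the set of nodes
  (see \<open>is_ptree\<close>), so that equality of records is equality of probabilistic trees.
\<close>

record 'ap ptree =
  nodes :: "nat list set"
  lab :: "nat list \<rightharpoonup> 'ap set"
  succs :: "nat list \<rightharpoonup> nat list pmf"

definition edge_prob :: "'ap ptree \<Rightarrow> nat list \<Rightarrow> nat list \<Rightarrow> real" where
  "edge_prob T \<pi> \<pi>' = (case succs T \<pi> of None \<Rightarrow> 0 | Some \<mu> \<Rightarrow> pmf \<mu> \<pi>')"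

text \<open>
  A tree has a root, so the empty set of nodes is excluded. The condition on \<open>edge_prob\<close>
  forces each distribution to live on \<open>nodes T\<close>, and \<open>succs T\<close> to be undefined exactly
  at the leaves.
\<close>

definition is_ptree :: "'ap ptree \<Rightarrow> bool" where
  "is_ptree T \<longleftrightarrow>
     nodes T \<noteq> {} \<and> [] \<notin> nodes T \<and>
     (\<forall>\<pi> \<in> nodes T \<union> {[]}. \<forall>\<pi>'. prefix \<pi>' \<pi> \<longrightarrow> \<pi>' \<in> nodes T \<union> {[]}) \<and>
     dom (lab T) = nodes T \<and>
     dom (succs T) \<subseteq> nodes T \<and>
     (\<forall>\<pi> \<in> nodes T. \<forall>\<pi>'. edge_prob T \<pi> \<pi>' > 0 \<longleftrightarrow> (\<exists>n. \<pi>' = \<pi> @ [n] \<and> \<pi>' \<in> nodes T))"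

definition total_ptrees :: "'ap ptree set" where
  "total_ptrees = {T. is_ptree T \<and> (\<forall>\<pi> \<in> nodes T. \<exists>\<pi>' \<in> nodes T. strict_prefix \<pi> \<pi>')}"

definition finite_depth_ptrees :: "'ap ptree set" where
  "finite_depth_ptrees = {T. is_ptree T \<and> (\<exists>n. \<forall>\<pi> \<in> nodes T. length \<pi> \<le> n)}"

definition ptree_prefix :: "'ap ptree \<Rightarrow> 'ap ptree \<Rightarrow> bool" (infix "\<preceq>" 50) where
  "T\<^sub>1 \<preceq> T\<^sub>2 \<longleftrightarrow>
     nodes T\<^sub>1 \<subseteq> nodes T\<^sub>2 \<and>
     lab T\<^sub>2 |` nodes T\<^sub>1 = lab T\<^sub>1 \<and>
     (\<forall>\<pi> \<in> nodes T\<^sub>1. \<forall>\<pi>' \<in> nodes T\<^sub>1. edge_prob T\<^sub>2 \<pi> \<pi>' = edge_prob T\<^sub>1 \<pi> \<pi>')"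

definition Pre_fin :: "'ap ptree \<Rightarrow> 'ap ptree set" where
  "Pre_fin T = {T\<^sub>1 \<in> finite_depth_ptrees. T\<^sub>1 \<preceq> T}"

definition safety_property :: "'ap ptree set \<Rightarrow> bool" where
  "safety_property Q \<longleftrightarrow>
     Q \<subseteq> total_ptrees \<and>
     (\<forall>T \<in> total_ptrees. T \<in> Q \<longleftrightarrow> (\<forall>T\<^sub>1 \<in> Pre_fin T. \<exists>T\<^sub>2 \<in> Q. T\<^sub>1 \<preceq> T\<^sub>2))"


section \<open>Markov chains and their unfoldings\<close>

record 'ap mc =
  states :: "nat set"
  trans_prob :: "nat \<Rightarrow> nat pmf"
  state_lab :: "nat \<Rightarrow> 'ap set"
  init :: nat

definition is_mc :: "'ap mc \<Rightarrow> bool" where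
  "is_mc D \<longleftrightarrow> init D \<in> states D \<and> (\<forall>s \<in> states D. set_pmf (trans_prob D s) \<subseteq> states D)"

inductive_set unfolding_nodes :: "'ap mc \<Rightarrow> nat list set" for D :: "'ap mc" where
  root: "[init D] \<in> unfolding_nodes D"
| step: "\<pi> \<in> unfolding_nodes D \<Longrightarrow> pmf (trans_prob D (last \<pi>)) t > 0 \<Longrightarrow> \<pi> @ [t] \<in> unfolding_nodes D"

definition unfolding_tree :: "'ap mc \<Rightarrow> 'ap ptree" where
  "unfolding_tree D =
     \<lparr> nodes = unfolding_nodes D,
       lab = (\<lambda>\<pi>. Some (state_lab D (last \<pi>))) |` unfolding_nodes D,
       succs = (\<lambda>\<pi>. Some (map_pmf (\<lambda>t. \<pi> @ [t]) (trans_prob D (last \<pi>)))) |` unfolding_nodes D \<rparr>"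

lemma edge_prob_unfolding_tree:
  assumes "\<pi> \<in> unfolding_nodes D"
  shows "edge_prob (unfolding_tree D) \<pi> (\<pi> @ [t]) = pmf (trans_prob D (last \<pi>)) t"
proof -
  have "inj (\<lambda>t. \<pi> @ [t])"
    by (auto simp: inj_def)
  from pmf_map_inj'[OF this, of "trans_prob D (last \<pi>)" t] show ?thesis
    using assms by (simp add: edge_prob_def unfolding_tree_def)
qed


section \<open>The probability measure on infinite paths\<close>

definition path_kernel :: "'ap mc \<Rightarrow> nat \<Rightarrow> nat \<Rightarrow> (nat \<Rightarrow> nat) \<Rightarrow> nat measure" where
  "path_kernel D s i \<omega> = measure_pmf (if i = 0 then return_pmf s else trans_prob D (\<omega> (i - 1)))"

text \<open>
  The measure given by the Ionescu-Tulcea theorem for the kernels above; it lives on the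
  \<open>\<sigma>\<close>-algebra generated by the cylinder sets, on which it takes the values stated in
  \<open>measure_path_measure_cylinder\<close> below.
\<close>

definition path_measure :: "'ap mc \<Rightarrow> nat \<Rightarrow> (nat \<Rightarrow> nat) measure" where
  "path_measure D s =
     projective_family.lim UNIV
       (Ionescu_Tulcea.CI (path_kernel D s) (\<lambda>_. count_space UNIV)) (\<lambda>_. count_space UNIV)"

lemma Ionescu_Tulcea_path_kernel: "Ionescu_Tulcea (path_kernel D s) (\<lambda>_. count_space UNIV)"
proof (rule Ionescu_Tulcea.intro)
  fix i
  show "path_kernel D s i \<in> measurable (PiM {0..<i} (\<lambda>_. count_space UNIV)) (subprob_algebra (count_space UNIV))"
  proof (cases i)
    case 0
    then show ?thesis
      by (simp add: path_kernel_def[abs_def] measure_pmf_in_subprob_algebra)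
  next
    case (Suc j)
    have "(\<lambda>\<omega>. \<omega> j) \<in> measurable (PiM {0..<i} (\<lambda>_. count_space UNIV)) (count_space (UNIV :: nat set))"
      using Suc by (intro measurable_component_singleton) auto
    moreover have "(\<lambda>t. measure_pmf (trans_prob D t)) \<in> measurable (count_space UNIV) (subprob_algebra (count_space UNIV))"
      by (simp add: measure_pmf_in_subprob_algebra)
    ultimately show ?thesis
      unfolding path_kernel_def[abs_def] using Suc
      by (auto intro: measurable_compose)
  qed
qed (simp add: path_kernel_def prob_space_measure_pmf)

lemma prob_space_path_measure: "prob_space (path_measure D s)"
proof -
  interpret IT: Ionescu_Tulcea "path_kernel D s" "\<lambda>_. count_space UNIV"
    by (rule Ionescu_Tulcea_path_kernel)
  have "prob_space (distr IT.PF.lim (PiM {} (\<lambda>_. count_space UNIV)) (\<lambda>x. restrict x {}))"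
    by (subst IT.distr_lim) (auto intro: IT.PF.prob_space_P)
  then show ?thesis
    unfolding path_measure_def
    by (rule prob_space_distrD[rotated])
       (auto intro!: measurable_restrict simp: measurable_cong_sets[OF IT.PF.sets_lim refl])
qed

lemma sets_path_measure: "sets (path_measure D s) = sets (PiM UNIV (\<lambda>_. count_space UNIV))"
proof -
  interpret IT: Ionescu_Tulcea "path_kernel D s" "\<lambda>_. count_space UNIV"
    by (rule Ionescu_Tulcea_path_kernel)
  show ?thesis
    unfolding path_measure_def by (rule IT.PF.sets_lim)
qed

lemma emeasure_path_measure_cylinder:
  "emeasure (path_measure D s) {\<omega>. \<forall>i\<le>n. \<omega> i = x i} =
     (if x 0 = s then \<Prod>i<n. ennreal (pmf (trans_prob D (x i)) (x (Suc i))) else 0)"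
proof -
  interpret IT: Ionescu_Tulcea "path_kernel D s" "\<lambda>_. count_space UNIV"
    by (rule Ionescu_Tulcea_path_kernel)
  let ?N = "\<lambda>_::nat. count_space (UNIV :: nat set)"
  let ?u = "\<lambda>_::nat. undefined :: nat"
  define Y where "Y m = {restrict x {0..<m}}" for m
  have Y_eq: "Y m = PiE {0..<m} (\<lambda>i. {x i})" for m
    unfolding Y_def by (auto simp: PiE_iff extensional_def fun_eq_iff)
  have Y[measurable]: "Y m \<in> sets (PiM {0..<m} ?N)" for m
    unfolding Y_eq by (intro sets_PiM_I_finite) auto
  have u: "?u \<in> space (PiM {0..<0} ?N)"
    by (simp add: space_PiM)
  have C_Suc: "emeasure (IT.C 0 (Suc m) ?u) (Y (Suc m)) =
      emeasure (path_kernel D s m (restrict x {0..<m})) {x m} * emeasure (IT.C 0 m ?u) (Y m)" for m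
  proof -
    have "emeasure (IT.C 0 (Suc m) ?u) (Y (Suc m)) =
        (\<integral>\<^sup>+\<omega>. emeasure (IT.eP m \<omega>) (Y (Suc m)) \<partial>IT.C 0 m ?u)"
      using IT.measurable_eP[of m] IT.sets_C[OF u, of m] IT.prob_space_C[OF u, of m]
      by (simp, subst emeasure_bind[where N = "PiM {0..<Suc m} ?N"])
         (auto simp: prob_space.not_empty measurable_cong_sets[OF IT.sets_C[OF u, simplified] refl])
    also have "\<dots> = (\<integral>\<^sup>+\<omega>. emeasure (path_kernel D s m (restrict x {0..<m})) {x m} * indicator (Y m) \<omega> \<partial>IT.C 0 m ?u)"
    proof (rule nn_integral_cong)
      fix \<omega> assume "\<omega> \<in> space (IT.C 0 m ?u)"
      then have w: "\<omega> \<in> space (PiM {0..<m} ?N)"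
        using IT.space_C[OF u, of m] by simp
      have ext: "\<omega> \<in> extensional {0..<m}"
        using w by (auto simp: space_PiM PiE_def)
      have "fun_upd \<omega> m -` Y (Suc m) = (if \<omega> = restrict x {0..<m} then {x m} else {})"
      proof -
        have "fun_upd \<omega> m t = restrict x {0..<Suc m} \<longleftrightarrow> \<omega> = restrict x {0..<m} \<and> t = x m" for t
          using ext unfolding fun_eq_iff extensional_def restrict_def fun_upd_def
          by (simp add: less_Suc_eq) (metis less_irrefl)
        then show ?thesis
          by (auto simp: Y_def)
      qed
      then show "emeasure (IT.eP m \<omega>) (Y (Suc m)) =
          emeasure (path_kernel D s m (restrict x {0..<m})) {x m} * indicator (Y m) \<omega>"
        using IT.emeasure_eP[OF w Y] by (auto simp: Y_def)
    qed
    also have "\<dots> = emeasure (path_kernel D s m (restrict x {0..<m})) {x m} * emeasure (IT.C 0 m ?u) (Y m)"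
      using IT.sets_C[OF u, of m] by (subst nn_integral_cmult_indicator) auto
    finally show ?thesis .
  qed
  have C: "emeasure (IT.C 0 (Suc m) ?u) (Y (Suc m)) =
     (if x 0 = s then \<Prod>i<m. ennreal (pmf (trans_prob D (x i)) (x (Suc i))) else 0)" for m
  proof (induction m)
    case 0
    have "emeasure (IT.C 0 0 ?u) (Y 0) = 1"
      using Y[of 0] by (simp add: Y_def restrict_def)
    moreover have "emeasure (path_kernel D s 0 (restrict x {0..<0})) {x 0} = (if x 0 = s then 1 else 0)"
      by (auto simp: path_kernel_def emeasure_pmf_single)
    ultimately show ?case
      unfolding C_Suc[of 0] by simp
  next
    case (Suc m)
    have "emeasure (path_kernel D s (Suc m) (restrict x {0..<Suc m})) {x (Suc m)} =
        ennreal (pmf (trans_prob D (x m)) (x (Suc m)))"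
      by (simp add: path_kernel_def emeasure_pmf_single)
    then show ?case
      unfolding C_Suc[of "Suc m"] Suc.IH by (simp add: mult.commute)
  qed
  have "{\<omega>. \<forall>i\<le>n. \<omega> i = x i} = IT.PF.emb UNIV {0..<Suc n} (Y (Suc n))"
    by (simp add: prod_emb_def Y_def fun_eq_iff restrict_def less_Suc_eq_le space_PiM set_eq_iff)
  also have "emeasure (path_measure D s) \<dots> = emeasure (IT.CI {0..<Suc n}) (Y (Suc n))"
    unfolding path_measure_def by (rule IT.lim) auto
  also have "\<dots> = emeasure (IT.C 0 (Suc n) ?u) (Y (Suc n))"
  proof -
    have "IT.PF.emb {0..<Suc n} {0..<Suc n} (Y (Suc n)) = Y (Suc n)"
      by (intro prod_emb_id) (auto simp: Y_def)
    then show ?thesis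
      using IT.emeasure_CI[of "{0..<Suc n}" "Suc n" "Y (Suc n)"] by simp
  qed
  finally show ?thesis
    unfolding C .
qed

lemma measure_path_measure_cylinder:
  "measure (path_measure D s) {\<omega>. \<forall>i\<le>n. \<omega> i = x i} =
     (if x 0 = s then \<Prod>i<n. pmf (trans_prob D (x i)) (x (Suc i)) else 0)"
  unfolding measure_def emeasure_path_measure_cylinder
  by (auto simp: prod_ennreal prod_nonneg)


section \<open>PCTL\<close>

datatype comparison = LT | GT | LE | GE

fun compare :: "comparison \<Rightarrow> real \<Rightarrow> real \<Rightarrow> bool" where
  "compare LT p q \<longleftrightarrow> p < q"
| "compare GT p q \<longleftrightarrow> p > q"
| "compare LE p q \<longleftrightarrow> p \<le> q"
| "compare GE p q \<longleftrightarrow> p \<ge> q"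

datatype 'ap state_formula =
    Atom 'ap
  | Neg "'ap state_formula"
  | And "'ap state_formula" "'ap state_formula"
  | Or "'ap state_formula" "'ap state_formula"
  | Prob comparison real "'ap path_formula"
and 'ap path_formula =
    Next "'ap state_formula"
  | Until "'ap state_formula" "'ap state_formula"
  | WUntil "'ap state_formula" "'ap state_formula"

primrec sat :: "'ap mc \<Rightarrow> 'ap state_formula \<Rightarrow> nat \<Rightarrow> bool"
  and path_sat :: "'ap mc \<Rightarrow> 'ap path_formula \<Rightarrow> (nat \<Rightarrow> nat) \<Rightarrow> bool"
where
  "sat D (Atom a) s \<longleftrightarrow> a \<in> state_lab D s"
| "sat D (Neg \<Phi>) s \<longleftrightarrow> \<not> sat D \<Phi> s"
| "sat D (And \<Phi>\<^sub>1 \<Phi>\<^sub>2) s \<longleftrightarrow> sat D \<Phi>\<^sub>1 s \<and> sat D \<Phi>\<^sub>2 s"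
| "sat D (Or \<Phi>\<^sub>1 \<Phi>\<^sub>2) s \<longleftrightarrow> sat D \<Phi>\<^sub>1 s \<or> sat D \<Phi>\<^sub>2 s"
| "sat D (Prob c q \<phi>) s \<longleftrightarrow> compare c (measure (path_measure D s) {\<omega>. path_sat D \<phi> \<omega>}) q"
| "path_sat D (Next \<Phi>) \<omega> \<longleftrightarrow> sat D \<Phi> (\<omega> 1)"
| "path_sat D (Until \<Phi>\<^sub>1 \<Phi>\<^sub>2) \<omega> \<longleftrightarrow> (\<exists>j. sat D \<Phi>\<^sub>2 (\<omega> j) \<and> (\<forall>i<j. sat D \<Phi>\<^sub>1 (\<omega> i)))"
| "path_sat D (WUntil \<Phi>\<^sub>1 \<Phi>\<^sub>2) \<omega> \<longleftrightarrow>
     (\<exists>j. sat D \<Phi>\<^sub>2 (\<omega> j) \<and> (\<forall>i<j. sat D \<Phi>\<^sub>1 (\<omega> i))) \<or> (\<forall>i. sat D \<Phi>\<^sub>1 (\<omega> i))"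

definition mc_sat :: "'ap mc \<Rightarrow> 'ap state_formula \<Rightarrow> bool" where
  "mc_sat D \<Phi> \<longleftrightarrow> sat D \<Phi> (init D)"

definition formula_property :: "'ap state_formula \<Rightarrow> 'ap ptree set" where
  "formula_property \<Phi> = {unfolding_tree D | D. is_mc D \<and> mc_sat D \<Phi>}"

definition safety_formula :: "'ap state_formula \<Rightarrow> bool" where
  "safety_formula \<Phi> \<longleftrightarrow> safety_property (formula_property \<Phi>)"


subsection \<open>Positive normal form\<close>

fun neg_comparison :: "comparison \<Rightarrow> comparison" where
  "neg_comparison LT = GE"
| "neg_comparison GT = LE"
| "neg_comparison LE = GT"
| "neg_comparison GE = LT"

text \<open>\<open>pnf \<Phi>\<close> and \<open>pnf_neg \<Phi>\<close> are the positive normal forms of \<open>\<Phi>\<close> and \<open>\<not>\<Phi>\<close>.\<close>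

fun pnf :: "'ap state_formula \<Rightarrow> 'ap state_formula"
  and pnf_neg :: "'ap state_formula \<Rightarrow> 'ap state_formula"
  and pnf_path :: "'ap path_formula \<Rightarrow> 'ap path_formula"
where
  "pnf (Atom a) = Atom a"
| "pnf (Neg \<Phi>) = pnf_neg \<Phi>"
| "pnf (And \<Phi>\<^sub>1 \<Phi>\<^sub>2) = And (pnf \<Phi>\<^sub>1) (pnf \<Phi>\<^sub>2)"
| "pnf (Or \<Phi>\<^sub>1 \<Phi>\<^sub>2) = Or (pnf \<Phi>\<^sub>1) (pnf \<Phi>\<^sub>2)"
| "pnf (Prob c q \<phi>) = Prob c q (pnf_path \<phi>)"
| "pnf_neg (Atom a) = Neg (Atom a)"
| "pnf_neg (Neg \<Phi>) = pnf \<Phi>"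
| "pnf_neg (And \<Phi>\<^sub>1 \<Phi>\<^sub>2) = Or (pnf_neg \<Phi>\<^sub>1) (pnf_neg \<Phi>\<^sub>2)"
| "pnf_neg (Or \<Phi>\<^sub>1 \<Phi>\<^sub>2) = And (pnf_neg \<Phi>\<^sub>1) (pnf_neg \<Phi>\<^sub>2)"
| "pnf_neg (Prob c q \<phi>) = Prob (neg_comparison c) q (pnf_path \<phi>)"
| "pnf_path (Next \<Phi>) = Next (pnf \<Phi>)"
| "pnf_path (Until \<Phi>\<^sub>1 \<Phi>\<^sub>2) = Until (pnf \<Phi>\<^sub>1) (pnf \<Phi>\<^sub>2)"
| "pnf_path (WUntil \<Phi>\<^sub>1 \<Phi>\<^sub>2) = WUntil (pnf \<Phi>\<^sub>1) (pnf \<Phi>\<^sub>2)"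

lemma sat_pnf:
  "sat D (pnf \<Phi>) s \<longleftrightarrow> sat D \<Phi> s"
  "sat D (pnf_neg \<Phi>) s \<longleftrightarrow> \<not> sat D \<Phi> s"
  "path_sat D (pnf_path \<phi>) \<omega> \<longleftrightarrow> path_sat D \<phi> \<omega>"
proof -
  have neg: "compare (neg_comparison c) p q \<longleftrightarrow> \<not> compare c p q" for c p q
    by (cases c) auto
  show "sat D (pnf \<Phi>) s \<longleftrightarrow> sat D \<Phi> s" "sat D (pnf_neg \<Phi>) s \<longleftrightarrow> \<not> sat D \<Phi> s"
    "path_sat D (pnf_path \<phi>) \<omega> \<longleftrightarrow> path_sat D \<phi> \<omega>"
    by (induction \<Phi> and \<Phi> and \<phi> arbitrary: s and s and \<omega> rule: pnf_pnf_neg_pnf_path.induct)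
       (auto simp: neg)
qed


subsection \<open>The safety fragment\<close>

inductive_set literal_formulas :: "'ap state_formula set" where
  lit_atom: "Atom a \<in> literal_formulas"
| lit_neg: "\<Phi> \<in> literal_formulas \<Longrightarrow> Neg \<Phi> \<in> literal_formulas"
| lit_and: "\<Phi>\<^sub>1 \<in> literal_formulas \<Longrightarrow> \<Phi>\<^sub>2 \<in> literal_formulas \<Longrightarrow> And \<Phi>\<^sub>1 \<Phi>\<^sub>2 \<in> literal_formulas"

text \<open>
  Formulas are taken in positive normal form, so in the rule for \<open>Until\<close> the formula \<open>\<not>\<Phi>\<^sub>i\<close> stands
  for its positive normal form; e.g. \<open>\<not>\<Phi>\<^sub>i\<close> is \<open>\<bbbP>\<^bsub>\<ge>q\<^esub>(\<phi>)\<close> for \<open>\<Phi>\<^sub>i = \<bbbP>\<^bsub><q\<^esub>(\<phi>)\<close>. With a purely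
  syntactic \<open>Neg \<Phi>\<^sub>i \<in> PCTL_safe\<close> the rule would only apply to literal formulas, a special case.
\<close>

inductive_set PCTL_safe :: "'ap state_formula set" where
  literal: "\<Phi> \<in> literal_formulas \<Longrightarrow> \<Phi> \<in> PCTL_safe"
| "next": "\<Phi> \<in> PCTL_safe \<Longrightarrow> 0 \<le> q \<Longrightarrow> q \<le> 1 \<Longrightarrow> Prob GE q (Next \<Phi>) \<in> PCTL_safe"
| conj: "\<Phi>\<^sub>1 \<in> PCTL_safe \<Longrightarrow> \<Phi>\<^sub>2 \<in> PCTL_safe \<Longrightarrow> And \<Phi>\<^sub>1 \<Phi>\<^sub>2 \<in> PCTL_safe"
| disj: "\<Phi>\<^sub>1 \<in> PCTL_safe \<Longrightarrow> \<Phi>\<^sub>2 \<in> PCTL_safe \<Longrightarrow> Or \<Phi>\<^sub>1 \<Phi>\<^sub>2 \<in> PCTL_safe"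
| wuntil: "\<Phi>\<^sub>1 \<in> PCTL_safe \<Longrightarrow> \<Phi>\<^sub>2 \<in> PCTL_safe \<Longrightarrow> 0 \<le> q \<Longrightarrow> q \<le> 1 \<Longrightarrow>
    Prob GE q (WUntil \<Phi>\<^sub>1 \<Phi>\<^sub>2) \<in> PCTL_safe"
| until: "pnf (Neg \<Phi>\<^sub>1) \<in> PCTL_safe \<Longrightarrow> pnf (Neg \<Phi>\<^sub>2) \<in> PCTL_safe \<Longrightarrow> 0 \<le> q \<Longrightarrow> q \<le> 1 \<Longrightarrow>
    Prob LE q (Until \<Phi>\<^sub>1 \<Phi>\<^sub>2) \<in> PCTL_safe"

end

theory Submission
  imports Defs
begin

text \<open>
  Truncating a total tree at depth \<open>n\<close> gives its largest prefix of depth \<open>n\<close>. If all truncations of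
  \<open>T\<close> extend to unfoldings of chains \<open>D\<^sub>n\<close>, then the labels and distributions in \<open>T\<close> depend on the
  last state of a node only, so \<open>T\<close> is itself the unfolding of a chain \<open>D\<close>, and \<open>D\<close> agrees with
  \<open>D\<^sub>n\<close> on the first \<open>n\<close> steps. It remains to see that the violation of a safe formula is visible at
  a finite depth. By induction on the formula, a bad event of paths is a countable increasing union
  of events each of which is determined by finitely many steps of the path and of the chain; by
  continuity of measure, exceeding a probability bound already happens for one of them.
\<close>

section \<open>Agreement of chains up to a finite depth\<close>

text \<open>Depth \<open>n\<close> compares the labels of \<open>n + 1\<close> levels but the
  distributions of only \<open>n\<close>, which is exactly the data that a truncated tree retains.
  States are compared by name, since the last entry of a node is its state.\<close>

primrec agree :: "nat \<Rightarrow> 'ap mc \<Rightarrow> 'ap mc \<Rightarrow> nat \<Rightarrow> bool" where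
  "agree 0 D D' s \<longleftrightarrow> state_lab D s = state_lab D' s"
| "agree (Suc n) D D' s \<longleftrightarrow> state_lab D s = state_lab D' s \<and> trans_prob D s = trans_prob D' s \<and>
     (\<forall>t \<in> set_pmf (trans_prob D s). agree n D D' t)"

lemma agree_SucD: "agree (Suc n) D D' s \<Longrightarrow> agree n D D' s"
  by (induction n arbitrary: s) auto

lemma agree_mono: "m \<le> n \<Longrightarrow> agree n D D' s \<Longrightarrow> agree m D D' s"
  by (induction n rule: dec_induct) (use agree_SucD in blast)+

lemma agree_state_lab: "agree n D D' s \<Longrightarrow> state_lab D s = state_lab D' s"
  by (cases n) auto

lemma agree_along_path:
  assumes "agree (n + m) D D' (x 0)" "\<And>i. i < n \<Longrightarrow> x (Suc i) \<in> set_pmf (trans_prob D (x i))"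
  shows "agree m D D' (x n)"
  using assms
proof (induction n arbitrary: m)
  case (Suc n)
  have "agree (Suc m) D D' (x n)"
    using Suc.prems by (intro Suc.IH) auto
  then show ?case
    using Suc.prems(2)[of n] by auto
qed simp

text \<open>Agreement says nothing about states outside the support of \<open>D\<close>. For a
  sequence that leaves it, some factor for \<open>D\<close> is zero, and the induction hypothesis
  carries the zero over to \<open>D'\<close>.\<close>

lemma agree_prod_trans_prob:
  assumes "agree n D D' (x 0)"
  shows "(\<Prod>i<n. pmf (trans_prob D (x i)) (x (Suc i))) =
    (\<Prod>i<n. pmf (trans_prob D' (x i)) (x (Suc i)))"
  using assms
proof (induction n)
  case (Suc n)
  note IH = Suc.IH[OF agree_SucD[OF Suc.prems]]
  show ?case
  proof (cases "\<forall>i<n. x (Suc i) \<in> set_pmf (trans_prob D (x i))")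
    case True
    then have "agree 1 D D' (x n)"
      using Suc.prems by (intro agree_along_path[of n 1 D D' x]) simp_all
    then show ?thesis
      using IH by simp
  next
    case False
    then obtain i where "i < n" "pmf (trans_prob D (x i)) (x (Suc i)) = 0"
      by (meson set_pmf_iff)
    then have "(\<Prod>i<n. pmf (trans_prob D (x i)) (x (Suc i))) = 0"
      by (intro prod_zero) auto
    with IH show ?thesis
      by (simp only: prod.lessThan_Suc mult_zero_left)
  qed
qed simp


section \<open>Events of the path measure determined by finitely many steps\<close>

lemma space_path_measure [simp]: "space (path_measure D s) = UNIV"
  using sets_eq_imp_space_eq[OF sets_path_measure[of D s]] by (simp add: space_PiM)

lemma measurable_path_component [measurable]:
  "(\<lambda>\<omega>. \<omega> i) \<in> measurable (path_measure D s) (count_space UNIV)"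
  unfolding measurable_cong_sets[OF sets_path_measure refl]
  by (rule measurable_component_singleton) simp

lemma vimage_path_prefix:
  "(\<lambda>\<omega>. map \<omega> [0..<Suc n]) -` {xs} =
    (if length xs = Suc n then {\<omega>. \<forall>i\<le>n. \<omega> i = xs ! i} else {})"
proof -
  have "map \<omega> [0..<Suc n] = xs \<longleftrightarrow> length xs = Suc n \<and> (\<forall>i\<le>n. \<omega> i = xs ! i)" for \<omega>
    unfolding list_eq_iff_nth_eq
    by (cases "length xs = Suc n") (simp_all add: less_Suc_eq_le del: upt_Suc)
  then show ?thesis
    by (auto simp del: upt_Suc)
qed

lemma sets_path_cylinder: "{\<omega>. \<forall>i\<le>n. \<omega> i = x i} \<in> sets (path_measure D s)"
proof -
  have "{\<omega> \<in> space (path_measure D s). \<forall>i\<le>n. \<omega> i = x i} \<in> sets (path_measure D s)"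
    by measurable
  then show ?thesis
    by simp
qed

lemma measurable_path_prefix:
  "(\<lambda>\<omega>. map \<omega> [0..<Suc n]) \<in> measurable (path_measure D s) (count_space UNIV)"
  unfolding measurable_count_space_eq_countable[OF countableI_type]
  by (auto simp: vimage_path_prefix sets_path_cylinder simp del: upt_Suc)

text \<open>Lists of states form a countable discrete space, so singletons suffice. Their preimages
  are cylinders, or empty for a wrong length.\<close>

lemma distr_path_prefix_agree:
  assumes "agree n D D' s"
  shows "distr (path_measure D s) (count_space UNIV) (\<lambda>\<omega>. map \<omega> [0..<Suc n]) =
    distr (path_measure D' s) (count_space UNIV) (\<lambda>\<omega>. map \<omega> [0..<Suc n])"
proof (rule measure_eqI_countable[where A = UNIV])
  fix xs :: "nat list"
  show "emeasure (distr (path_measure D s) (count_space UNIV) (\<lambda>\<omega>. map \<omega> [0..<Suc n])) {xs} =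
    emeasure (distr (path_measure D' s) (count_space UNIV) (\<lambda>\<omega>. map \<omega> [0..<Suc n])) {xs}"
    using agree_prod_trans_prob[of n D D' "(!) xs"] assms
    by (simp add: emeasure_distr measurable_path_prefix vimage_path_prefix
        emeasure_path_measure_cylinder prod_ennreal del: upt_Suc)
qed auto

text \<open>An event that ignores the positions after \<open>n\<close> is a union of fibres of the
  prefix map. This reduces its measurability and its measure to the law of the prefix.\<close>

lemma path_prefix_event:
  assumes "\<And>\<omega> \<omega>'. \<omega> \<in> E \<Longrightarrow> (\<forall>i\<le>n. \<omega>' i = \<omega> i) \<Longrightarrow> \<omega>' \<in> E"
  shows "E = (\<lambda>\<omega>. map \<omega> [0..<Suc n]) -` (\<lambda>\<omega>. map \<omega> [0..<Suc n]) ` E"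
proof -
  have "\<omega>' \<in> E" if "\<omega> \<in> E" "map \<omega>' [0..<Suc n] = map \<omega> [0..<Suc n]" for \<omega> \<omega>'
    using that assms[of \<omega> \<omega>'] by (auto simp: less_Suc_eq_le simp del: upt_Suc)
  then show ?thesis
    by blast
qed

lemma sets_path_prefix_event:
  assumes "\<And>\<omega> \<omega>'. \<omega> \<in> E \<Longrightarrow> (\<forall>i\<le>n. \<omega>' i = \<omega> i) \<Longrightarrow> \<omega>' \<in> E"
  shows "E \<in> sets (path_measure D s)"
proof -
  let ?f = "\<lambda>\<omega>. map \<omega> [0..<Suc n]"
  have "?f -` ?f ` E \<inter> space (path_measure D s) \<in> sets (path_measure D s)"
    using measurable_path_prefix by (rule measurable_sets) simp
  moreover have "E = ?f -` ?f ` E"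
    using assms by (rule path_prefix_event)
  ultimately show ?thesis
    by (simp del: upt_Suc)
qed

lemma measure_path_prefix_event_agree:
  assumes "agree n D D' s" "\<And>\<omega> \<omega>'. \<omega> \<in> E \<Longrightarrow> (\<forall>i\<le>n. \<omega>' i = \<omega> i) \<Longrightarrow> \<omega>' \<in> E"
  shows "measure (path_measure D s) E = measure (path_measure D' s) E"
proof -
  let ?f = "\<lambda>\<omega>. map \<omega> [0..<Suc n]"
  have E: "E = ?f -` ?f ` E"
    using assms(2) by (rule path_prefix_event)
  have "measure (path_measure D s) E = measure (path_measure D s) (?f -` ?f ` E)"
    using E by (rule arg_cong)
  also have "\<dots> = measure (distr (path_measure D s) (count_space UNIV) ?f) (?f ` E)"
    by (subst measure_distr[OF measurable_path_prefix]) (simp_all del: upt_Suc)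
  also have "\<dots> = measure (distr (path_measure D' s) (count_space UNIV) ?f) (?f ` E)"
    unfolding distr_path_prefix_agree[OF assms(1)] ..
  also have "\<dots> = measure (path_measure D' s) (?f -` ?f ` E)"
    by (subst measure_distr[OF measurable_path_prefix]) (simp_all del: upt_Suc)
  also have "\<dots> = measure (path_measure D' s) E"
    using E[symmetric] by (rule arg_cong)
  finally show ?thesis .
qed

section \<open>Almost sure properties of paths\<close>

lemma AE_path_measure_start: "AE \<omega> in path_measure D s. \<omega> 0 = s"
proof -
  interpret prob_space "path_measure D s"
    by (rule prob_space_path_measure)
  have "prob {\<omega>. \<omega> 0 = s} = 1"
    using measure_path_measure_cylinder[of D s 0 "\<lambda>_. s"] by simp
  then show ?thesis
    using prob_eq_1[of "{\<omega>. \<omega> 0 = s}"] sets_path_cylinder[of 0 "\<lambda>_. s" D s] by simp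
qed

lemma AE_path_measure_trans:
  "AE \<omega> in path_measure D s. \<forall>i. \<omega> (Suc i) \<in> set_pmf (trans_prob D (\<omega> i))"
  unfolding AE_all_countable
proof
  fix i
  let ?f = "\<lambda>\<omega>. map \<omega> [0..<Suc (Suc i)]"
  \<comment> \<open>The prefixes whose last transition is impossible. There are countably many, and
    each cylinder is null because the last factor of its product is zero.\<close>
  define N where "N = {xs. length xs = Suc (Suc i) \<and>
    xs ! Suc i \<notin> set_pmf (trans_prob D (xs ! i))}"
  have "{\<omega>. \<forall>j\<le>Suc i. \<omega> j = xs ! j} \<in> null_sets (path_measure D s)" if "xs \<in> N" for xs
    using that sets_path_cylinder[of "Suc i" "(!) xs" D s]
    by (auto simp: null_sets_def N_def emeasure_path_measure_cylinder set_pmf_iff)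
  then have "(\<Union>xs\<in>N. {\<omega>. \<forall>j\<le>Suc i. \<omega> j = xs ! j}) \<in> null_sets (path_measure D s)"
    by (intro null_sets_UN') auto
  moreover have "\<omega> \<in> (\<Union>xs\<in>N. {\<omega>. \<forall>j\<le>Suc i. \<omega> j = xs ! j})"
    if "\<omega> (Suc i) \<notin> set_pmf (trans_prob D (\<omega> i))" for \<omega>
    using that by (intro UN_I[of "?f \<omega>"]) (auto simp: N_def less_Suc_eq_le simp del: upt_Suc)
  ultimately show "AE \<omega> in path_measure D s. \<omega> (Suc i) \<in> set_pmf (trans_prob D (\<omega> i))"
    by (intro AE_I'[of "\<Union>xs\<in>N. {\<omega>. \<forall>j\<le>Suc i. \<omega> j = xs ! j}"]) auto
qed


section \<open>Properties witnessed at a finite depth\<close>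

text \<open>Openness, where the basic neighbourhoods of \<open>D\<close> consist of the chains that
  agree with it from \<open>s\<close> to some finite depth.\<close>

definition finitely_witnessed :: "('ap mc \<Rightarrow> nat \<Rightarrow> bool) \<Rightarrow> bool" where
  "finitely_witnessed P \<longleftrightarrow> (\<forall>D s. P D s \<longrightarrow> (\<exists>n. \<forall>D'. agree n D D' s \<longrightarrow> P D' s))"

text \<open>Here a neighbourhood also fixes a prefix of the path. Only paths of positive transitions
  count: agreement of chains controls just the states reached along them, and they have probability
  one.\<close>

definition finitely_witnessed_path :: "('ap mc \<Rightarrow> (nat \<Rightarrow> nat) \<Rightarrow> bool) \<Rightarrow> bool" where
  "finitely_witnessed_path Q \<longleftrightarrow> (\<forall>D \<omega>. Q D \<omega> \<longrightarrow>
     (\<forall>i. \<omega> (Suc i) \<in> set_pmf (trans_prob D (\<omega> i))) \<longrightarrow>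
     (\<exists>n. \<forall>D' \<omega>'. agree n D D' (\<omega> 0) \<longrightarrow> (\<forall>i\<le>n. \<omega>' i = \<omega> i) \<longrightarrow> Q D' \<omega>'))"

lemma finitely_witnessed_conj:
  assumes "finitely_witnessed P" "finitely_witnessed R"
  shows "finitely_witnessed (\<lambda>D s. P D s \<and> R D s)"
  unfolding finitely_witnessed_def
proof (intro allI impI)
  fix D s
  assume "P D s \<and> R D s"
  then obtain m n where "\<And>D'. agree m D D' s \<Longrightarrow> P D' s" "\<And>D'. agree n D D' s \<Longrightarrow> R D' s"
    using assms unfolding finitely_witnessed_def by metis
  then have "\<forall>D'. agree (max m n) D D' s \<longrightarrow> P D' s \<and> R D' s"
    by (meson agree_mono max.cobounded1 max.cobounded2)
  then show "\<exists>n. \<forall>D'. agree n D D' s \<longrightarrow> P D' s \<and> R D' s" ..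
qed

lemma finitely_witnessed_disj:
  assumes "finitely_witnessed P" "finitely_witnessed R"
  shows "finitely_witnessed (\<lambda>D s. P D s \<or> R D s)"
  using assms unfolding finitely_witnessed_def by metis

lemma finitely_witnessed_path_state:
  assumes "finitely_witnessed P"
  shows "finitely_witnessed_path (\<lambda>D \<omega>. P D (\<omega> k))"
  unfolding finitely_witnessed_path_def
proof (intro allI impI)
  fix D \<omega>
  assume "P D (\<omega> k)" and path: "\<forall>i. \<omega> (Suc i) \<in> set_pmf (trans_prob D (\<omega> i))"
  then obtain n where n: "\<And>D'. agree n D D' (\<omega> k) \<Longrightarrow> P D' (\<omega> k)"
    using assms unfolding finitely_witnessed_def by metis
  have "\<forall>D' \<omega>'. agree (k + n) D D' (\<omega> 0) \<longrightarrow> (\<forall>i\<le>k + n. \<omega>' i = \<omega> i) \<longrightarrow> P D' (\<omega>' k)"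
    using n agree_along_path path by (metis le_add1)
  then show "\<exists>n. \<forall>D' \<omega>'. agree n D D' (\<omega> 0) \<longrightarrow> (\<forall>i\<le>n. \<omega>' i = \<omega> i) \<longrightarrow> P D' (\<omega>' k)" ..
qed

lemma finitely_witnessed_path_conj:
  assumes "finitely_witnessed_path Q" "finitely_witnessed_path R"
  shows "finitely_witnessed_path (\<lambda>D \<omega>. Q D \<omega> \<and> R D \<omega>)"
  unfolding finitely_witnessed_path_def
proof (intro allI impI)
  fix D \<omega>
  assume "Q D \<omega> \<and> R D \<omega>" "\<forall>i. \<omega> (Suc i) \<in> set_pmf (trans_prob D (\<omega> i))"
  then obtain m n where
    m: "\<And>D' \<omega>'. agree m D D' (\<omega> 0) \<Longrightarrow> \<forall>i\<le>m. \<omega>' i = \<omega> i \<Longrightarrow> Q D' \<omega>'" and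
    n: "\<And>D' \<omega>'. agree n D D' (\<omega> 0) \<Longrightarrow> \<forall>i\<le>n. \<omega>' i = \<omega> i \<Longrightarrow> R D' \<omega>'"
    using assms unfolding finitely_witnessed_path_def by metis
  have "Q D' \<omega>' \<and> R D' \<omega>'" if "agree (max m n) D D' (\<omega> 0)" "\<forall>i\<le>max m n. \<omega>' i = \<omega> i" for D' \<omega>'
  proof
    show "Q D' \<omega>'"
      using that agree_mono[of m "max m n" D D' "\<omega> 0"] by (intro m) auto
    show "R D' \<omega>'"
      using that agree_mono[of n "max m n" D D' "\<omega> 0"] by (intro n) auto
  qed
  then show "\<exists>n. \<forall>D' \<omega>'. agree n D D' (\<omega> 0) \<longrightarrow> (\<forall>i\<le>n. \<omega>' i = \<omega> i) \<longrightarrow> Q D' \<omega>' \<and> R D' \<omega>'"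
    by blast
qed

lemma finitely_witnessed_path_all_less:
  assumes "finitely_witnessed P"
  shows "finitely_witnessed_path (\<lambda>D \<omega>. \<forall>i<k::nat. P D (\<omega> i))"
proof (induction k)
  case 0
  show ?case
    by (simp add: finitely_witnessed_path_def)
next
  case (Suc k)
  show ?case
    using finitely_witnessed_path_conj[OF finitely_witnessed_path_state[OF assms, of k] Suc.IH]
    by (simp add: less_Suc_eq all_conj_distrib imp_disjL conj_commute)
qed

text \<open>For fixed \<open>j\<close> this is a finite conjunction on the first
  \<open>j + 1\<close> states. The quantifier over \<open>j\<close> is harmless, since the depth may
  depend on the path.\<close>

lemma finitely_witnessed_path_until:
  assumes "finitely_witnessed P" "finitely_witnessed R"
  shows "finitely_witnessed_path (\<lambda>D \<omega>. \<exists>j. R D (\<omega> j) \<and> (\<forall>i<j. P D (\<omega> i)))"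
proof -
  have "finitely_witnessed_path (\<lambda>D \<omega>. R D (\<omega> j) \<and> (\<forall>i<j. P D (\<omega> i)))" for j
    by (intro finitely_witnessed_path_conj finitely_witnessed_path_state
        finitely_witnessed_path_all_less assms)
  then show ?thesis
    unfolding finitely_witnessed_path_def by metis
qed

text \<open>Continuity from below: up to a null set, increasing events decided at finite depth
  exhaust the event, so one of them already has probability above \<open>r\<close>. This relies on
  the bound being strict.\<close>

lemma finitely_witnessed_prob_greater:
  fixes Q :: "'ap mc \<Rightarrow> (nat \<Rightarrow> nat) \<Rightarrow> bool"
  assumes Q: "finitely_witnessed_path Q"
    and meas: "\<And>D s. {\<omega>. Q D \<omega>} \<in> sets (path_measure D s)"
  shows "finitely_witnessed (\<lambda>D s. measure (path_measure D s) {\<omega>. Q D \<omega>} > r)"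
  unfolding finitely_witnessed_def
proof (intro allI impI)
  fix D :: "'ap mc" and s
  interpret prob_space "path_measure D s"
    by (rule prob_space_path_measure)
  assume r: "r < prob {\<omega>. Q D \<omega>}"
  \<comment> \<open>Quantifying over all agreeing \<open>D'\<close> inside the event gives one set
    that depends on positions up to \<open>n\<close> only and lies in the event of every such chain.
    Its probability can thus be moved from \<open>D\<close> to \<open>D'\<close>.\<close>
  define E where "E n = {\<omega>. \<forall>D' \<omega>'. agree n D D' s \<longrightarrow> (\<forall>i\<le>n. \<omega>' i = \<omega> i) \<longrightarrow> Q D' \<omega>'}" for n
  have prefix_event: "\<omega>' \<in> E n" if "\<omega> \<in> E n" "\<forall>i\<le>n. \<omega>' i = \<omega> i" for n \<omega> \<omega>'
    using that unfolding E_def by simp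
  have sets_E: "range E \<subseteq> events"
  proof
    fix A
    assume "A \<in> range E"
    then obtain n where A: "A = E n" ..
    show "A \<in> events"
      unfolding A using prefix_event[of _ n] by (rule sets_path_prefix_event)
  qed
  have "incseq E"
  proof (rule incseq_SucI, rule subsetI)
    fix n \<omega>
    assume "\<omega> \<in> E n"
    then show "\<omega> \<in> E (Suc n)"
      unfolding E_def by (blast intro: agree_SucD le_SucI)
  qed
  then have lim: "(\<lambda>n. prob (E n)) \<longlonglongrightarrow> prob (\<Union>n. E n)"
    using sets_E by (intro finite_Lim_measure_incseq)
  \<comment> \<open>A witnessing depth exists on paths of positive transitions, and starting in
    \<open>s\<close> turns agreement from \<open>\<omega> 0\<close> into agreement from
    \<open>s\<close>. Both hold almost surely.\<close>
  have "AE \<omega> in path_measure D s. \<omega> \<in> {\<omega>. Q D \<omega>} \<longrightarrow> \<omega> \<in> (\<Union>n. E n)"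
    using AE_path_measure_start AE_path_measure_trans
  proof eventually_elim
    case (elim \<omega>)
    then show ?case
      using Q unfolding finitely_witnessed_path_def E_def by auto
  qed
  then have "prob {\<omega>. Q D \<omega>} \<le> prob (\<Union>n. E n)"
    using sets_E by (intro finite_measure_mono_AE) auto
  with r have "r < prob (\<Union>n. E n)"
    by simp
  then have "eventually (\<lambda>n. r < prob (E n)) sequentially"
    using order_tendstoD(1)[OF lim] by simp
  then obtain n where n: "r < prob (E n)"
    by (auto simp: eventually_sequentially)
  have "r < measure (path_measure D' s) {\<omega>. Q D' \<omega>}" if agree: "agree n D D' s" for D'
  proof -
    interpret D': prob_space "path_measure D' s"
      by (rule prob_space_path_measure)
    have "r < D'.prob (E n)"
      using n measure_path_prefix_event_agree[OF agree prefix_event] by simp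
    also have "\<dots> \<le> D'.prob {\<omega>. Q D' \<omega>}"
      using agree meas by (intro D'.finite_measure_mono) (auto simp: E_def)
    finally show ?thesis .
  qed
  then show "\<exists>n. \<forall>D'. agree n D D' s \<longrightarrow> r < measure (path_measure D' s) {\<omega>. Q D' \<omega>}"
    by blast
qed


section \<open>Violations of safe formulas\<close>

text \<open>State formulas define sets of states, and all of these are measurable. Hence only the
  outer path operator is inspected, without induction.\<close>

lemma sets_path_sat: "{\<omega>. path_sat D \<phi> \<omega>} \<in> sets (path_measure D' s)"
proof -
  have "{\<omega> \<in> space (path_measure D' s). path_sat D \<phi> \<omega>} \<in> sets (path_measure D' s)"
    by (cases \<phi>; simp only: path_sat.simps; measurable)
  then show ?thesis
    by simp
qed

text \<open>The complement turns a failed lower bound into a strict lower bound for the bad paths,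
  the form to which continuity from below applies.\<close>

lemma not_sat_Prob_GE_iff:
  "\<not> sat D (Prob GE q \<phi>) s \<longleftrightarrow> measure (path_measure D s) {\<omega>. \<not> path_sat D \<phi> \<omega>} > 1 - q"
proof -
  interpret prob_space "path_measure D s"
    by (rule prob_space_path_measure)
  have "prob {\<omega>. \<not> path_sat D \<phi> \<omega>} = 1 - prob {\<omega>. path_sat D \<phi> \<omega>}"
    using prob_compl[OF sets_path_sat[of D \<phi>]] by (simp add: Compl_eq_Diff_UNIV[symmetric] Compl_eq)
  then show ?thesis
    by auto
qed

lemma sets_not_path_sat: "{\<omega>. \<not> path_sat D \<phi> \<omega>} \<in> sets (path_measure D' s)"
  using sets.compl_sets[OF sets_path_sat[of D \<phi> D' s]]
  by (simp add: Compl_eq_Diff_UNIV[symmetric] Compl_eq)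

lemma finitely_witnessed_not_Prob_GE:
  assumes "finitely_witnessed_path (\<lambda>D \<omega>. \<not> path_sat D \<phi> \<omega>)"
  shows "finitely_witnessed (\<lambda>D s. \<not> sat D (Prob GE q \<phi>) s)"
  unfolding not_sat_Prob_GE_iff
  using assms sets_not_path_sat by (rule finitely_witnessed_prob_greater)

text \<open>The duality of weak until and until: the right side is the until formula built from
  \<open>\<not> \<Phi>\<^sub>2\<close> and
  \<open>\<not> \<Phi>\<^sub>1 \<and> \<not> \<Phi>\<^sub>2\<close>, so failure shows on a finite
  prefix.\<close>

lemma not_path_sat_WUntil_iff:
  "\<not> path_sat D (WUntil \<Phi>\<^sub>1 \<Phi>\<^sub>2) \<omega> \<longleftrightarrow>
    (\<exists>j. (\<not> sat D \<Phi>\<^sub>1 (\<omega> j) \<and> \<not> sat D \<Phi>\<^sub>2 (\<omega> j)) \<and> (\<forall>i<j. \<not> sat D \<Phi>\<^sub>2 (\<omega> i)))"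
  (is "?L \<longleftrightarrow> ?R")
proof
  assume L: ?L
  define j where "j = (LEAST j. \<not> sat D \<Phi>\<^sub>1 (\<omega> j))"
  have "\<exists>j. \<not> sat D \<Phi>\<^sub>1 (\<omega> j)"
    using L by auto
  then have j: "\<not> sat D \<Phi>\<^sub>1 (\<omega> j)"
    unfolding j_def by (rule LeastI_ex)
  have less: "sat D \<Phi>\<^sub>1 (\<omega> i)" if "i < j" for i
    using not_less_Least that unfolding j_def by blast
  \<comment> \<open>If \<open>\<Phi>\<^sub>2\<close> held at such an \<open>i\<close>, then
    \<open>\<Phi>\<^sub>1\<close> would hold at all earlier positions by minimality of
    \<open>j\<close>, and the until part would be satisfied.\<close>
  have "\<not> sat D \<Phi>\<^sub>2 (\<omega> i)" if "i \<le> j" for i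
    using L less that by (auto dest: order.strict_trans2)
  with j show ?R
    by auto
next
  assume ?R
  then show ?L
    by (metis linorder_neqE_nat path_sat.simps(3))
qed

lemma literal_formulas_sat_cong:
  assumes "\<Phi> \<in> literal_formulas" "state_lab D s = state_lab D' s"
  shows "sat D \<Phi> s \<longleftrightarrow> sat D' \<Phi> s"
  using assms by induction auto

lemma finitely_witnessed_not_sat:
  assumes "\<Phi> \<in> PCTL_safe"
  shows "finitely_witnessed (\<lambda>D s. \<not> sat D \<Phi> s)"
  using assms
proof induction
  case (literal \<Phi>)
  then show ?case
    unfolding finitely_witnessed_def by (metis agree_state_lab literal_formulas_sat_cong)
next
  case ("next" \<Phi> q)
  then have "finitely_witnessed_path (\<lambda>D \<omega>. \<not> path_sat D (Next \<Phi>) \<omega>)"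
    using finitely_witnessed_path_state[of _ 1] by simp
  then show ?case
    by (rule finitely_witnessed_not_Prob_GE)
next
  case (conj \<Phi>\<^sub>1 \<Phi>\<^sub>2)
  then show ?case
    by (simp only: sat.simps de_Morgan_conj finitely_witnessed_disj)
next
  case (disj \<Phi>\<^sub>1 \<Phi>\<^sub>2)
  then show ?case
    by (simp only: sat.simps de_Morgan_disj finitely_witnessed_conj)
next
  case (wuntil \<Phi>\<^sub>1 \<Phi>\<^sub>2 q)
  then have "finitely_witnessed_path (\<lambda>D \<omega>. \<not> path_sat D (WUntil \<Phi>\<^sub>1 \<Phi>\<^sub>2) \<omega>)"
    unfolding not_path_sat_WUntil_iff
    by (intro finitely_witnessed_path_until finitely_witnessed_conj)
  then show ?case
    by (rule finitely_witnessed_not_Prob_GE)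
next
  case (until \<Phi>\<^sub>1 \<Phi>\<^sub>2 q)
  \<comment> \<open>The induction hypotheses concern violations of the negations, so by
    \<open>sat_pnf\<close> satisfaction of \<open>\<Phi>\<^sub>1\<close> and
    \<open>\<Phi>\<^sub>2\<close> is finitely witnessed. Exceeding an upper bound is already strict,
    so no complement is taken.\<close>
  then have "finitely_witnessed_path (\<lambda>D \<omega>. path_sat D (Until \<Phi>\<^sub>1 \<Phi>\<^sub>2) \<omega>)"
    using finitely_witnessed_path_until by (simp add: sat_pnf)
  then have "finitely_witnessed (\<lambda>D s. measure (path_measure D s) {\<omega>. path_sat D (Until \<Phi>\<^sub>1 \<Phi>\<^sub>2) \<omega>} > q)"
    using sets_path_sat by (rule finitely_witnessed_prob_greater)
  then show ?case
    by (simp add: not_le)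
qed


section \<open>Unfoldings and truncations\<close>

lemma unfolding_nodes_hd: "\<pi> \<in> unfolding_nodes D \<Longrightarrow> \<pi> \<noteq> [] \<and> hd \<pi> = init D"
  by (induction rule: unfolding_nodes.induct) auto

lemma unfolding_nodes_prefix:
  assumes "\<pi> \<in> unfolding_nodes D" "prefix \<pi>' \<pi>"
  shows "\<pi>' \<in> unfolding_nodes D \<union> {[]}"
  using assms
proof induction
  case root
  then show ?case
    by (auto simp: prefix_Cons intro: unfolding_nodes.root)
next
  case (step \<pi> t)
  then show ?case
    by (auto simp: prefix_snoc intro: unfolding_nodes.step)
qed

lemma edge_prob_unfolding_tree_pos_iff:
  assumes "\<pi> \<in> unfolding_nodes D"
  shows "edge_prob (unfolding_tree D) \<pi> \<pi>' > 0 \<longleftrightarrow>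
    (\<exists>t. \<pi>' = \<pi> @ [t] \<and> \<pi>' \<in> unfolding_nodes D)"
proof -
  have "edge_prob (unfolding_tree D) \<pi> \<pi>' > 0 \<longleftrightarrow>
      \<pi>' \<in> (\<lambda>t. \<pi> @ [t]) ` set_pmf (trans_prob D (last \<pi>))"
    using assms by (simp add: edge_prob_def unfolding_tree_def pmf_positive_iff)
  moreover have "t \<in> set_pmf (trans_prob D (last \<pi>))" if "\<pi> @ [t] \<in> unfolding_nodes D" for t
    using that by cases (use assms unfolding_nodes_hd in \<open>auto simp: pmf_positive_iff\<close>)
  ultimately show ?thesis
    using unfolding_nodes.step[OF assms] by (auto simp: pmf_positive_iff)
qed

lemma unfolding_tree_total: "unfolding_tree D \<in> total_ptrees"
proof -
  have "\<exists>\<pi>' \<in> unfolding_nodes D. strict_prefix \<pi> \<pi>'" if "\<pi> \<in> unfolding_nodes D" for \<pi>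
  proof -
    obtain t where "t \<in> set_pmf (trans_prob D (last \<pi>))"
      using set_pmf_not_empty by fast
    then have "\<pi> @ [t] \<in> unfolding_nodes D"
      using that by (intro unfolding_nodes.step) (auto simp: pmf_positive_iff)
    then show ?thesis
      by (auto intro!: bexI[of _ "\<pi> @ [t]"] simp: strict_prefix_def)
  qed
  moreover have "is_ptree (unfolding_tree D)"
    unfolding is_ptree_def
    using unfolding_nodes_prefix[of _ D] unfolding_nodes.root[of D] unfolding_nodes_hd[of _ D]
      edge_prob_unfolding_tree_pos_iff[of _ D]
    by (auto simp: unfolding_tree_def split: if_splits)
  ultimately show ?thesis
    by (simp add: total_ptrees_def unfolding_tree_def)
qed

text \<open>Nodes of length exactly \<open>n\<close> keep their label but lose their distribution,
  because they become leaves. As nodes have length at least one, depth \<open>0\<close> leaves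
  nothing.\<close>

definition truncate :: "nat \<Rightarrow> 'ap ptree \<Rightarrow> 'ap ptree" where
  "truncate n T =
     \<lparr> nodes = {\<pi> \<in> nodes T. length \<pi> \<le> n},
       lab = lab T |` {\<pi> \<in> nodes T. length \<pi> \<le> n},
       succs = succs T |` {\<pi> \<in> nodes T. length \<pi> < n} \<rparr>"

lemma edge_prob_truncate:
  "edge_prob (truncate n T) \<pi> \<pi>' = (if \<pi> \<in> nodes T \<and> length \<pi> < n then edge_prob T \<pi> \<pi>' else 0)"
  by (simp add: edge_prob_def truncate_def restrict_map_def)

lemma is_ptree_prefix:
  "is_ptree T \<Longrightarrow> \<pi> \<in> nodes T \<Longrightarrow> prefix \<pi>' \<pi> \<Longrightarrow> \<pi>' \<noteq> [] \<Longrightarrow> \<pi>' \<in> nodes T"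
  unfolding is_ptree_def by blast

lemma is_ptree_edge_prob_pos_iff:
  "is_ptree T \<Longrightarrow> \<pi> \<in> nodes T \<Longrightarrow>
    edge_prob T \<pi> \<pi>' > 0 \<longleftrightarrow> (\<exists>n. \<pi>' = \<pi> @ [n] \<and> \<pi>' \<in> nodes T)"
  unfolding is_ptree_def by blast

lemma is_ptree_truncate:
  assumes T: "is_ptree T" and n: "n \<ge> 1"
  shows "is_ptree (truncate n T)"
  unfolding is_ptree_def
proof (intro conjI ballI allI impI)
  obtain \<pi> where \<pi>: "\<pi> \<in> nodes T" "\<pi> \<noteq> []"
    using T unfolding is_ptree_def by blast
  then have "[hd \<pi>] \<in> nodes T"
    by (intro is_ptree_prefix[OF T \<pi>(1)]) (auto simp: prefix_def neq_Nil_conv)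
  then show "nodes (truncate n T) \<noteq> {}"
    using n by (auto simp: truncate_def)
  show "[] \<notin> nodes (truncate n T)"
    using T by (auto simp: truncate_def is_ptree_def)
  show "\<pi>' \<in> nodes (truncate n T) \<union> {[]}"
    if "\<pi> \<in> nodes (truncate n T) \<union> {[]}" "prefix \<pi>' \<pi>" for \<pi> \<pi>'
    using that is_ptree_prefix[OF T, of \<pi> \<pi>'] prefix_length_le[OF that(2)]
    by (auto simp: truncate_def)
  show "dom (lab (truncate n T)) = nodes (truncate n T)"
    using T by (auto simp: truncate_def is_ptree_def)
  show "dom (succs (truncate n T)) \<subseteq> nodes (truncate n T)"
    by (auto simp: truncate_def)
  show "0 < edge_prob (truncate n T) \<pi> \<pi>' \<longleftrightarrow> (\<exists>m. \<pi>' = \<pi> @ [m] \<and> \<pi>' \<in> nodes (truncate n T))"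
    if "\<pi> \<in> nodes (truncate n T)" for \<pi> \<pi>'
  proof -
    have "\<pi> \<in> nodes T" "length \<pi> \<le> n"
      using that by (auto simp: truncate_def)
    then show ?thesis
      unfolding edge_prob_truncate using is_ptree_edge_prob_pos_iff[OF T, of \<pi> \<pi>']
      by (auto simp: truncate_def)
  qed
qed

lemma truncate_ptree_prefix:
  assumes T: "is_ptree T"
  shows "truncate n T \<preceq> T"
proof -
  have "edge_prob T \<pi> \<pi>' = edge_prob (truncate n T) \<pi> \<pi>'"
    if "\<pi> \<in> nodes T" "length \<pi> \<le> n" "length \<pi>' \<le> n" for \<pi> \<pi>'
  proof (cases "length \<pi> < n")
    \<comment> \<open>At the cut-off level the probability in \<open>T\<close> vanishes as well: a
      child of \<open>\<pi>\<close> has length \<open>n + 1\<close>, but \<open>\<pi>'\<close> has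
      length at most \<open>n\<close>.\<close>
    case False
    then have "\<not> edge_prob T \<pi> \<pi>' > 0"
      using that is_ptree_edge_prob_pos_iff[OF T that(1)] by auto
    moreover have "edge_prob T \<pi> \<pi>' \<ge> 0"
      by (simp add: edge_prob_def split: option.split)
    ultimately show ?thesis
      using False by (simp add: edge_prob_truncate)
  qed (use that in \<open>simp add: edge_prob_truncate\<close>)
  then show ?thesis
    by (auto simp: ptree_prefix_def truncate_def)
qed

lemma truncate_in_Pre_fin: "is_ptree T \<Longrightarrow> n \<ge> 1 \<Longrightarrow> truncate n T \<in> Pre_fin T"
  using is_ptree_truncate truncate_ptree_prefix
  by (fastforce simp: Pre_fin_def finite_depth_ptrees_def truncate_def)


section \<open>Trees whose truncations extend to unfoldings\<close>

text \<open>Both total masses are one, so if the distributions differed, some point would have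
  strictly more mass under \<open>p\<close>, and it would lie in the support of
  \<open>p\<close>.\<close>

lemma pmf_eqI_on_support:
  assumes "\<And>x. x \<in> set_pmf p \<Longrightarrow> pmf p x = pmf q x"
  shows "p = q"
proof (rule ccontr)
  assume "p \<noteq> q"
  then obtain x where "pmf q x < pmf p x"
    using pmf_neq_exists_less[of q p] by auto
  then show False
    using assms[of x] pmf_nonneg[of q x] by (auto simp: set_pmf_iff)
qed

lemma truncate_prefix_unfolding_lab:
  assumes "truncate n T \<preceq> unfolding_tree D" "\<pi> \<in> nodes T" "length \<pi> \<le> n"
  shows "\<pi> \<in> unfolding_nodes D" "lab T \<pi> = Some (state_lab D (last \<pi>))"
proof -
  have nodes: "\<pi> \<in> nodes (truncate n T)"
    using assms by (simp add: truncate_def)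
  then show unf: "\<pi> \<in> unfolding_nodes D"
    using assms(1) by (auto simp: ptree_prefix_def unfolding_tree_def)
  have "lab (unfolding_tree D) \<pi> = lab (truncate n T) \<pi>"
    using assms(1) nodes by (metis ptree_prefix_def restrict_in)
  then show "lab T \<pi> = Some (state_lab D (last \<pi>))"
    using unf nodes by (simp add: unfolding_tree_def truncate_def)
qed

text \<open>The prefix relation compares probabilities only between nodes of the truncation, so
  \<open>D\<close> might have further successors. No mass is left for them, as the probabilities in
  \<open>T\<close> already sum to one.\<close>

lemma truncate_prefix_unfolding_succs:
  assumes prefix: "truncate n T \<preceq> unfolding_tree D"
    and T: "T \<in> total_ptrees" and \<pi>: "\<pi> \<in> nodes T" "length \<pi> < n"
  shows "succs T \<pi> = Some (map_pmf (\<lambda>t. \<pi> @ [t]) (trans_prob D (last \<pi>)))"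
proof -
  have ptree: "is_ptree T"
    using T by (simp add: total_ptrees_def)
  obtain \<pi>' where "\<pi>' \<in> nodes T" "strict_prefix \<pi> \<pi>'"
    using T \<pi>(1) by (auto simp: total_ptrees_def)
  then obtain t \<rho> where "\<pi> @ t # \<rho> \<in> nodes T"
    by (auto elim!: strict_prefixE')
  then have "\<pi> @ [t] \<in> nodes T"
    by (rule is_ptree_prefix[OF ptree]) auto
  then have "edge_prob T \<pi> (\<pi> @ [t]) > 0"
    using is_ptree_edge_prob_pos_iff[OF ptree \<pi>(1)] by auto
  then obtain \<mu> where \<mu>: "succs T \<pi> = Some \<mu>"
    by (auto simp: edge_prob_def split: option.splits)
  have unf: "\<pi> \<in> unfolding_nodes D"
    using truncate_prefix_unfolding_lab[OF prefix \<pi>(1)] \<pi>(2) by simp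
  have "\<mu> = map_pmf (\<lambda>t. \<pi> @ [t]) (trans_prob D (last \<pi>))"
  proof (rule pmf_eqI_on_support)
    fix \<rho>
    assume "\<rho> \<in> set_pmf \<mu>"
    then have "edge_prob T \<pi> \<rho> > 0"
      using \<mu> by (simp add: edge_prob_def pmf_positive_iff)
    then obtain t where "\<rho> = \<pi> @ [t]" "\<rho> \<in> nodes T"
      using is_ptree_edge_prob_pos_iff[OF ptree \<pi>(1)] by auto
    then have "\<pi> \<in> nodes (truncate n T)" "\<rho> \<in> nodes (truncate n T)"
      using \<pi> by (auto simp: truncate_def)
    then have "edge_prob (unfolding_tree D) \<pi> \<rho> = edge_prob (truncate n T) \<pi> \<rho>"
      using prefix by (simp add: ptree_prefix_def)
    then show "pmf \<mu> \<rho> = pmf (map_pmf (\<lambda>t. \<pi> @ [t]) (trans_prob D (last \<pi>))) \<rho>"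
      unfolding edge_prob_truncate using unf \<pi> \<mu>
      by (simp add: edge_prob_def unfolding_tree_def)
  qed
  with \<mu> show ?thesis
    by simp
qed

lemma map_pmf_last_snoc: "map_pmf last (map_pmf (\<lambda>t. \<pi> @ [t]) p) = p"
  by (simp add: pmf.map_comp comp_def)

lemma limit_of_unfoldings:
  fixes T :: "'ap ptree" and Ds :: "nat \<Rightarrow> 'ap mc"
  assumes T: "T \<in> total_ptrees"
    and prefix: "\<And>n. n \<ge> 1 \<Longrightarrow> truncate n T \<preceq> unfolding_tree (Ds n)"
  obtains D where "is_mc D" "unfolding_tree D = T"
proof -
  have ptree: "is_ptree T"
    using T by (simp add: total_ptrees_def)
  \<comment> \<open>Any node ending in \<open>s\<close> may define the behaviour of
    \<open>s\<close>; the facts \<open>D\<close> below show that the choice does not matter.\<close>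
  define rep where "rep s = (SOME \<pi>. \<pi> \<in> nodes T \<and> last \<pi> = s)" for s
  have rep: "rep (last \<pi>) \<in> nodes T" "last (rep (last \<pi>)) = last \<pi>" if "\<pi> \<in> nodes T" for \<pi>
    using someI[of "\<lambda>\<rho>. \<rho> \<in> nodes T \<and> last \<rho> = last \<pi>" \<pi>] that by (auto simp: rep_def)
  define D :: "'ap mc" where
    "D = \<lparr> states = last ` nodes T,
           trans_prob = (\<lambda>s. map_pmf last (the (succs T (rep s)))),
           state_lab = (\<lambda>s. the (lab T (rep s))),
           init = init (Ds 1) \<rparr>"
  have D: "lab T \<pi> = Some (state_lab D (last \<pi>))"
    "succs T \<pi> = Some (map_pmf (\<lambda>t. \<pi> @ [t]) (trans_prob D (last \<pi>)))" if "\<pi> \<in> nodes T" for \<pi>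
  proof -
    \<comment> \<open>Deep enough for one chain \<open>Ds n\<close> to account for both
      \<open>\<pi>\<close> and the representative of its last state. Both end in the same state of
      that chain, and \<open>Suc\<close> keeps both above the cut-off level, so they have the same
      label and transition distribution.\<close>
    define n where "n = Suc (max (length \<pi>) (length (rep (last \<pi>))))"
    have n: "truncate n T \<preceq> unfolding_tree (Ds n)" "length \<pi> < n" "length (rep (last \<pi>)) < n"
      using prefix[of n] by (auto simp: n_def)
    show "lab T \<pi> = Some (state_lab D (last \<pi>))"
      using truncate_prefix_unfolding_lab(2)[OF n(1) that]
        truncate_prefix_unfolding_lab(2)[OF n(1) rep(1)[OF that]] n rep(2)[OF that]
      by (simp add: D_def)
    show "succs T \<pi> = Some (map_pmf (\<lambda>t. \<pi> @ [t]) (trans_prob D (last \<pi>)))"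
      using truncate_prefix_unfolding_succs[OF n(1) T that]
        truncate_prefix_unfolding_succs[OF n(1) T rep(1)[OF that]] n rep(2)[OF that]
      by (simp add: D_def map_pmf_last_snoc)
  qed
  have step: "\<pi> @ [t] \<in> nodes T \<longleftrightarrow> pmf (trans_prob D (last \<pi>)) t > 0" if "\<pi> \<in> nodes T" for \<pi> t
  proof -
    have "\<pi> @ [t] \<in> nodes T \<longleftrightarrow> edge_prob T \<pi> (\<pi> @ [t]) > 0"
      using is_ptree_edge_prob_pos_iff[OF ptree that] by auto
    also have "\<dots> \<longleftrightarrow> pmf (trans_prob D (last \<pi>)) t > 0"
      using D(2)[OF that] by (auto simp: edge_prob_def pmf_positive_iff)
    finally show ?thesis .
  qed
  obtain \<rho> where "\<rho> \<in> nodes T" "\<rho> \<noteq> []"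
    using ptree unfolding is_ptree_def by blast
  then have "[hd \<rho>] \<in> nodes T"
    by (intro is_ptree_prefix[OF ptree \<open>\<rho> \<in> nodes T\<close>]) (auto simp: prefix_def neq_Nil_conv)
  \<comment> \<open>A tree may have several nodes of length one. Here the truncation at depth one
    lies in an unfolding, whose only such node is \<open>[init (Ds 1)]\<close>.\<close>
  have root: "r = init D" if "[r] \<in> nodes T" for r
    using unfolding_nodes_hd[OF truncate_prefix_unfolding_lab(1)[OF prefix[of 1] that]]
    by (simp add: D_def)
  have init: "[init D] \<in> nodes T"
    using root \<open>[hd \<rho>] \<in> nodes T\<close> by metis
  have "\<pi> \<in> nodes T" if "\<pi> \<in> unfolding_nodes D" for \<pi>
    using that by induction (use init step in auto)
  moreover have "\<pi> \<in> unfolding_nodes D" if "\<pi> \<in> nodes T" for \<pi>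
    using that
  proof (induction \<pi> rule: rev_induct)
    case Nil
    then show ?case
      using ptree by (simp add: is_ptree_def)
  next
    case (snoc t \<pi>)
    show ?case
    proof (cases "\<pi> = []")
      case True
      then show ?thesis
        using snoc.prems root[of t] by (simp add: unfolding_nodes.root)
    next
      case False
      then have "\<pi> \<in> nodes T"
        using is_ptree_prefix[OF ptree snoc.prems, of \<pi>] by simp
      then show ?thesis
        using snoc step by (intro unfolding_nodes.step) auto
    qed
  qed
  ultimately have nodes: "unfolding_nodes D = nodes T"
    by blast
  have lab_outside: "lab T \<pi> = None" and succs_outside: "succs T \<pi> = None"
    if "\<pi> \<notin> nodes T" for \<pi>
    using ptree that by (auto simp: is_ptree_def dom_def)
  have "lab (unfolding_tree D) = lab T"
  proof
    fix \<pi>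
    show "lab (unfolding_tree D) \<pi> = lab T \<pi>"
      using D(1)[of \<pi>] lab_outside[of \<pi>]
      by (cases "\<pi> \<in> nodes T") (simp_all add: unfolding_tree_def nodes)
  qed
  moreover have "succs (unfolding_tree D) = succs T"
  proof
    fix \<pi>
    show "succs (unfolding_tree D) \<pi> = succs T \<pi>"
      using D(2)[of \<pi>] succs_outside[of \<pi>]
      by (cases "\<pi> \<in> nodes T") (simp_all add: unfolding_tree_def nodes)
  qed
  ultimately have "unfolding_tree D = T"
    by (simp add: unfolding_tree_def nodes)
  moreover have "is_mc D"
  proof -
    have "init D \<in> states D"
      using init by (force simp: D_def)
    moreover have "t \<in> states D"
      if "\<pi> \<in> nodes T" "t \<in> set_pmf (trans_prob D (last \<pi>))" for \<pi> t
    proof -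
      have "\<pi> @ [t] \<in> nodes T"
        using step that by (simp add: pmf_positive_iff)
      then show ?thesis
        by (force simp: D_def)
    qed
    moreover have "states D = last ` nodes T"
      by (simp add: D_def)
    ultimately show ?thesis
      by (auto simp: is_mc_def)
  qed
  ultimately show thesis
    using that by blast
qed

text \<open>Below \<open>\<pi>\<close> the truncation keeps \<open>n - length \<pi>\<close> levels,
  and each fixes one more step of the chain. At \<open>k = 0\<close> the node may be a leaf of the
  truncation, where only the label is known.\<close>

lemma truncate_prefix_unfolding_agree:
  assumes prefix: "truncate n (unfolding_tree D) \<preceq> unfolding_tree D'"
    and "\<pi> \<in> unfolding_nodes D" "length \<pi> + k \<le> n"
  shows "agree k D D' (last \<pi>)"
  using assms(2,3)
proof (induction k arbitrary: \<pi>)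
  case 0
  then show ?case
    using truncate_prefix_unfolding_lab(2)[OF prefix, of \<pi>] by (simp add: unfolding_tree_def)
next
  case (Suc k)
  have \<pi>: "\<pi> \<in> nodes (unfolding_tree D)"
    using Suc.prems by (simp add: unfolding_tree_def)
  have "state_lab D (last \<pi>) = state_lab D' (last \<pi>)"
    using truncate_prefix_unfolding_lab(2)[OF prefix \<pi>] Suc.prems by (simp add: unfolding_tree_def)
  moreover have "map_pmf (\<lambda>t. \<pi> @ [t]) (trans_prob D (last \<pi>)) =
      map_pmf (\<lambda>t. \<pi> @ [t]) (trans_prob D' (last \<pi>))"
    using truncate_prefix_unfolding_succs[OF prefix unfolding_tree_total \<pi>] Suc.prems
    by (simp add: unfolding_tree_def)
  then have "trans_prob D (last \<pi>) = trans_prob D' (last \<pi>)"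
    by (metis map_pmf_last_snoc)
  moreover have "agree k D D' t" if "t \<in> set_pmf (trans_prob D (last \<pi>))" for t
  proof -
    have "\<pi> @ [t] \<in> unfolding_nodes D"
      using that Suc.prems by (intro unfolding_nodes.step) (auto simp: pmf_positive_iff)
    then show ?thesis
      using Suc.IH[of "\<pi> @ [t]"] Suc.prems by simp
  qed
  ultimately show ?case
    by simp
qed

section \<open>Closure under limits of truncations\<close>

lemma safety_property_formula_property:
  fixes \<Phi> :: "'ap state_formula"
  assumes violation: "finitely_witnessed (\<lambda>D s. \<not> sat D \<Phi> s)"
  shows "safety_property (formula_property \<Phi>)"
  unfolding safety_property_def
proof (intro conjI ballI iffI)
  show "formula_property \<Phi> \<subseteq> total_ptrees"
    by (auto simp: formula_property_def unfolding_tree_total)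
next
  fix T T\<^sub>1 :: "'ap ptree"
  assume "T \<in> formula_property \<Phi>" "T\<^sub>1 \<in> Pre_fin T"
  then show "\<exists>T\<^sub>2 \<in> formula_property \<Phi>. T\<^sub>1 \<preceq> T\<^sub>2"
    by (auto simp: Pre_fin_def)
next
  fix T :: "'ap ptree"
  assume T: "T \<in> total_ptrees" and pre: "\<forall>T\<^sub>1 \<in> Pre_fin T. \<exists>T\<^sub>2 \<in> formula_property \<Phi>. T\<^sub>1 \<preceq> T\<^sub>2"
  have "\<forall>n. \<exists>D'. n \<ge> 1 \<longrightarrow> truncate n T \<preceq> unfolding_tree D' \<and> mc_sat D' \<Phi>"
  proof
    fix n
    show "\<exists>D'. n \<ge> 1 \<longrightarrow> truncate n T \<preceq> unfolding_tree D' \<and> mc_sat D' \<Phi>"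
      using T pre truncate_in_Pre_fin[of T n] by (fastforce simp: total_ptrees_def formula_property_def)
  qed
  then obtain Ds where Ds: "\<And>n. n \<ge> 1 \<Longrightarrow> truncate n T \<preceq> unfolding_tree (Ds n)"
    "\<And>n. n \<ge> 1 \<Longrightarrow> mc_sat (Ds n) \<Phi>"
    by metis
  obtain D where D: "is_mc D" "unfolding_tree D = T"
    using limit_of_unfoldings[OF T Ds(1)] .
  \<comment> \<open>The root has length one, so depth \<open>Suc n\<close> of the tree leaves
    \<open>n\<close> steps of the chain.\<close>
  have agree: "agree n D (Ds (Suc n)) (init D)" for n
    using truncate_prefix_unfolding_agree[of "Suc n" D _ "[init D]" n] Ds(1)[of "Suc n"] D(2)
      unfolding_nodes.root[of D] by simp
  have init: "init (Ds (Suc n)) = init D" for n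
    using truncate_prefix_unfolding_lab(1)[of "Suc n" T _ "[init D]"] Ds(1)[of "Suc n"] D(2)
      unfolding_nodes.root[of D] unfolding_nodes_hd by (fastforce simp: unfolding_tree_def)
  \<comment> \<open>Otherwise the violation at \<open>init D\<close> is witnessed at some depth
    \<open>n\<close>, and \<open>Ds (Suc n)\<close>, which agrees with \<open>D\<close> to that
    depth and has the same initial state, would violate \<open>\<Phi>\<close> too.\<close>
  have "sat D \<Phi> (init D)"
    using violation agree init Ds(2) unfolding finitely_witnessed_def mc_sat_def
    by (metis le_add1 plus_1_eq_Suc)
  with D show "T \<in> formula_property \<Phi>"
    by (auto simp: formula_property_def mc_sat_def)
qed

theorem theorem4:
  fixes \<Phi> :: "('ap::finite) state_formula"
  assumes "\<Phi> \<in> PCTL_safe"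
  shows "safety_formula \<Phi>"
  unfolding safety_formula_def
  using assms by (intro safety_property_formula_property finitely_witnessed_not_sat)

end
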